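(* Let $q$ be a prime power, let $n, k \in \mathbb{Z}^+$, and let $S$ be a set of $k$ points in $\mathrm{AG}(n,q)$. Then there are at least \[ \mathfrak{m}(\underbrace{q,\dots,q}_{n};\, nq - k + 1) - 1 \] hyperplanes of $\mathrm{AG}(n,q)$ which do not meet $S$.
   Context: $\mathrm{AG}(n,q)$ is the $n$-dimensional affine space over the finite field $\mathbb{F}_q$ (identified with $\mathbb{F}_q^n$); its hyperplanes are the affine hyperplanes. For positive integers $a_1,\dots,a_n$ and an integer $N$ with $n \le N \le \sum a_i$, $\mathfrak{m}(a_1,\dots,a_n;N)$ is the minimum of $\prod_{i=1}^n y_i$ over all tuples of integers $(y_1,\dots,y_n)$ with $1 \le y_i \le a_i$ for all $i$ and $\sum_{i=1}^n y_i = N$; for $N<n$ define $\mathfrak{m}(a_1,\dots,a_n;N)=1$. *)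

theory Defs
  imports "HOL-Analysis.Cartesian_Space"
begin

text \<open>
  The points of the affine space of dimension CARD('n) over a field 'a are the vectors in 'a ^ 'n.
  Linear notions are those of the vector space interpretation vec (over an arbitrary field),
  not the real ones.
\<close>

definition affine_hyperplane :: "('a::field ^ 'n) set \<Rightarrow> bool" where
  "affine_hyperplane H \<longleftrightarrow>
     (\<exists>W v. vec.subspace W \<and> vec.dim W = CARD('n) - 1 \<and> H = (\<lambda>w. v + w) ` W)"

definition bounded_tuples :: "nat list \<Rightarrow> int \<Rightarrow> nat list set" where
  "bounded_tuples as N =
     {ys. length ys = length as \<and> (\<forall>i<length as. 1 \<le> ys ! i \<and> ys ! i \<le> as ! i) \<and>
          int (sum_list ys) = N}"

text \<open>
  The sum bound N is an integer because it may be negative. The set of tuples is finite, and it is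
  nonempty if all entries of as are positive and length as \<le> N \<le> sum_list as; for
  N > sum_list as it is empty and the value is unspecified.
\<close>

definition min_prod :: "nat list \<Rightarrow> int \<Rightarrow> nat" where
  "min_prod as N =
     (if N < int (length as) then 1 else Min (prod_list ` bounded_tuples as N))"

end

theory Submission
  imports Defs "HOL-Computational_Algebra.Polynomial"
begin

text \<open>
  Translate so that the origin lies in S. The hyperplanes missing the origin are the sets
  \<open>{x. a \<bullet> x = 1}\<close> with \<open>a \<noteq> 0\<close>, and such a hyperplane misses S iff a is not a zero of
  \<open>\<Prod>x\<in>S-{0}. (a \<bullet> x - 1)\<close>. As a function of a this polynomial has degree at most \<open>k - 1\<close>,
  and it does not vanish at \<open>a = 0\<close>. The Alon--Fueredi theorem bounds the number of its nonzeros
  from below; the \<open>- 1\<close> in the claim accounts for \<open>a = 0\<close>, which defines no hyperplane.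
\<close>

section \<open>Polynomial functions over a finite field\<close>

text \<open>Multiplication by a nonzero \<open>t\<close> permutes the nonzero elements, so their
  product equals itself times \<open>t ^ (q - 1)\<close>, and cancelling leaves
  \<open>t ^ (q - 1) = 1\<close>.\<close>

lemma power_card_eq_self:
  fixes t :: "'a::{field,finite}"
  shows "t ^ CARD('a) = t"
proof (cases "t = 0")
  case True
  then show ?thesis by (simp add: power_0_left)
next
  case False
  let ?U = "UNIV - {0::'a}"
  have bij: "bij_betw ((*) t) ?U ?U"
    by (rule bij_betwI[where g = "\<lambda>x. x / t"]) (use False in auto)
  have "(\<Prod>x\<in>?U. x) = (\<Prod>x\<in>?U. t * x)"
    using prod.reindex_bij_betw[OF bij, of "\<lambda>x. x"] by simp
  also have "\<dots> = t ^ card ?U * (\<Prod>x\<in>?U. x)"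
    by (simp add: prod.distrib)
  finally have "t ^ card ?U = 1" by simp
  moreover have "CARD('a) = Suc (card ?U)"
    by (rule card.remove) simp_all
  ultimately show ?thesis by (metis power_Suc mult.right_neutral)
qed

text \<open>
  Degrees are integers so that the bound \<open>d - j\<close> for a coefficient is not truncated; for a
  negative bound only the zero function remains.
\<close>

inductive polyfun :: "'i set \<Rightarrow> int \<Rightarrow> (('i \<Rightarrow> 'a::field) \<Rightarrow> 'a) \<Rightarrow> bool" for I where
  zero: "polyfun I d (\<lambda>x. 0)"
| const: "0 \<le> d \<Longrightarrow> polyfun I d (\<lambda>x. c)"
| add: "polyfun I d f \<Longrightarrow> polyfun I d g \<Longrightarrow> polyfun I d (\<lambda>x. f x + g x)"
| var: "i \<in> I \<Longrightarrow> polyfun I d f \<Longrightarrow> polyfun I (d + 1) (\<lambda>x. x i * f x)"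

lemma polyfun_mono: "polyfun I d f \<Longrightarrow> d \<le> e \<Longrightarrow> polyfun I e f"
proof (induction arbitrary: e rule: polyfun.induct)
  case (var i d f)
  then show ?case using polyfun.var[of i I "e - 1" f] by simp
qed (simp_all add: polyfun.zero polyfun.const polyfun.add)

lemma polyfun_neg: "polyfun I d f \<Longrightarrow> d < 0 \<Longrightarrow> f x = 0"
  by (induction rule: polyfun.induct) auto

lemma polyfun_cong_on:
  "polyfun I d f \<Longrightarrow> (\<And>i. i \<in> I \<Longrightarrow> x i = y i) \<Longrightarrow> f x = f y"
  by (induction rule: polyfun.induct) auto

lemma polyfun_scale: "polyfun I d f \<Longrightarrow> polyfun I d (\<lambda>x. c * f x)"
proof (induction rule: polyfun.induct)
  case (var i d f)
  then show ?case using polyfun.var[of i I d "\<lambda>x. c * f x"] by (simp add: mult.left_commute)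
qed (simp_all add: distrib_left polyfun.zero polyfun.const polyfun.add)

lemma polyfun_sum:
  "(\<And>j. j \<in> J \<Longrightarrow> polyfun I d (f j)) \<Longrightarrow> polyfun I d (\<lambda>x. \<Sum>j\<in>J. f j x)"
  by (induction J rule: infinite_finite_induct) (simp_all add: polyfun.zero polyfun.add)

lemma polyfun_mult_affine:
  fixes f :: "('i::finite \<Rightarrow> 'a::field) \<Rightarrow> 'a"
  assumes "polyfun UNIV d f"
  shows "polyfun UNIV (d + 1) (\<lambda>x. ((\<Sum>i\<in>UNIV. x i * u i) + b) * f x)"
proof -
  have "polyfun UNIV (d + 1) (\<lambda>x. (\<Sum>i\<in>UNIV. x i * (u i * f x)) + b * f x)"
    using assms polyfun_mono[OF assms, of "d + 1"]
    by (intro polyfun.add polyfun_sum polyfun.var polyfun_scale) auto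
  then show ?thesis
    by (simp add: distrib_right sum_distrib_right mult.assoc)
qed

lemma polyfun_prod_affine:
  fixes u :: "'j \<Rightarrow> 'i::finite \<Rightarrow> 'a::field"
  assumes "finite J"
  shows "polyfun UNIV (int (card J)) (\<lambda>x. \<Prod>j\<in>J. (\<Sum>i\<in>UNIV. x i * u j i) + b j)"
  using assms
proof (induction J)
  case empty
  then show ?case by (simp add: polyfun.const)
next
  case (insert j J)
  then have "int (card (insert j J)) = int (card J) + 1" by simp
  then show ?case
    using insert.hyps polyfun_mult_affine[OF insert.IH, of "u j" "b j"]
    by (simp del: card_insert_disjoint)
qed

text \<open>Singles out one variable for the induction in \<open>alon_fueredi\<close>. All exponents
  of \<open>x i\<close> can be kept below the field size, and the coefficient of
  \<open>x i ^ j\<close> gives up \<open>j\<close> of the degree. Only multiplication by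
  \<open>x i\<close> itself shifts the coefficients.\<close>

lemma polyfun_insert:
  fixes f :: "('i \<Rightarrow> 'a::{field,finite}) \<Rightarrow> 'a"
  assumes "polyfun (insert i I) d f"
  shows "\<exists>c. (\<forall>j. polyfun I (d - int j) (c j)) \<and> (\<forall>x. f x = (\<Sum>j<CARD('a). c j x * x i ^ j))"
  using assms
proof (induction rule: polyfun.induct)
  case (zero d)
  show ?case by (rule exI[of _ "\<lambda>j x. 0"]) (simp add: polyfun.zero)
next
  case (const d a)
  have "(\<Sum>j<CARD('a). (if j = 0 then a else 0) * x i ^ j) = a" for x :: "'i \<Rightarrow> 'a"
    by (subst sum.remove[of _ 0]) (auto simp: sum.neutral)
  then show ?case using const
    by (intro exI[of _ "\<lambda>j x. if j = 0 then a else 0"]) (simp add: polyfun.zero polyfun.const)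
next
  case (add d f g)
  then obtain c c' where
    "\<forall>j. polyfun I (d - int j) (c j)" "\<forall>x. f x = (\<Sum>j<CARD('a). c j x * x i ^ j)"
    "\<forall>j. polyfun I (d - int j) (c' j)" "\<forall>x. g x = (\<Sum>j<CARD('a). c' j x * x i ^ j)"
    by blast
  then show ?case
    by (intro exI[of _ "\<lambda>j x. c j x + c' j x"])
      (simp add: polyfun.add distrib_right sum.distrib)
next
  case (var k d f)
  then obtain c where c: "\<And>j. polyfun I (d - int j) (c j)"
    and f: "\<And>x. f x = (\<Sum>j<CARD('a). c j x * x i ^ j)"
    by blast
  show ?case
  proof (cases "k = i")
    case False
    with var have "k \<in> I" by simp
    then have "polyfun I (d + 1 - int j) (\<lambda>x. x k * c j x)" for j
      using polyfun.var[OF _ c[of j]] by (simp add: algebra_simps)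
    then show ?thesis
      by (intro exI[of _ "\<lambda>j x. x k * c j x"]) (simp add: f sum_distrib_left mult.assoc)
  next
    case True
    \<comment> \<open>A field has at least two elements, so exponent 1 is among those
      allowed.\<close>
    obtain m where q: "CARD('a) = Suc m" and m: "m \<ge> 1"
    proof -
      have "card {0, 1::'a} \<le> CARD('a)" by (intro card_mono) auto
      then show thesis by (intro that[of "CARD('a) - 1"]) auto
    qed
    \<comment> \<open>the top coefficient wraps around to exponent 1, because \<open>t ^ q = t\<close>\<close>
    define c' where
      "c' j x = (if j = 0 then 0 else c (j - 1) x) + (if j = 1 then c m x else 0)" for j x
    have "polyfun I (d + 1 - int j) (c' j)" for j
    proof -
      have "polyfun I (d + 1 - int j) (c (j - 1))" if "j \<noteq> 0"
        using c[of "j - 1"] that by (simp add: of_nat_diff algebra_simps)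
      \<comment> \<open>At exponent 1 degree \<open>d\<close> is allowed, while \<open>c m\<close>
        only has degree \<open>d - m\<close>.\<close>
      moreover have "polyfun I (d + 1 - int j) (c m)" if "j = 1"
        using that by (intro polyfun_mono[OF c[of m]]) auto
      ultimately show ?thesis
        unfolding c'_def
        by (cases "j = 0"; cases "j = 1") (simp_all add: polyfun.zero polyfun.add)
    qed
    moreover have "x k * f x = (\<Sum>j<CARD('a). c' j x * x i ^ j)" for x
    proof -
      have wrap: "x i * x i ^ m = x i"
        using power_card_eq_self[of "x i"] by (simp add: q)
      have "(\<Sum>j<CARD('a). c' j x * x i ^ j) = (\<Sum>j<m. c' (Suc j) x * x i ^ Suc j)"
        by (simp add: q sum.lessThan_Suc_shift c'_def del: sum.lessThan_Suc)
      also have "\<dots> = (\<Sum>j<m. c j x * x i ^ Suc j) + (\<Sum>j<m. (if j = 0 then c m x * x i else 0))"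
        unfolding sum.distrib[symmetric]
        by (intro sum.cong) (auto simp: c'_def distrib_right)
      also have "(\<Sum>j<m. (if j = 0 then c m x * x i else 0)) = c m x * x i"
        using m by (simp add: sum.delta)
      also have "(\<Sum>j<m. c j x * x i ^ Suc j) + c m x * x i = x i * f x"
      proof -
        have "x i * (c m x * x i ^ m) = c m x * x i"
          using wrap by (simp add: mult.left_commute[of "x i"])
        then show ?thesis
          by (simp add: f q distrib_left sum_distrib_left mult.left_commute[of "x i"])
      qed
      finally show ?thesis by (simp add: True)
    qed
    ultimately show ?thesis by blast
  qed
qed

section \<open>The Alon--Fueredi bound\<close>

text \<open>A nonzero polynomial of degree at most \<open>e\<close> has at most \<open>e\<close>
  roots.\<close>

lemma card_nonroots_ge:
  fixes c :: "nat \<Rightarrow> 'a::{field,finite}"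
  assumes "c e \<noteq> 0"
  shows "CARD('a) - e \<le> card {t. (\<Sum>j\<le>e. c j * t ^ j) \<noteq> 0}"
proof -
  define p where "p = (\<Sum>j\<le>e. monom (c j) j)"
  have "coeff p e = c e" by (simp add: p_def coeff_sum)
  then have p: "p \<noteq> 0" using assms by auto
  have "degree p \<le> e"
    unfolding p_def by (intro degree_sum_le) (auto intro: order_trans[OF degree_monom_le])
  then have "card {t. poly p t = 0} \<le> e"
    using card_poly_roots_bound[OF p] by simp
  moreover have "card {t. poly p t \<noteq> 0} = CARD('a) - card {t. poly p t = 0}"
    by (simp add: Collect_neg_eq Compl_eq_Diff_UNIV card_Diff_subset)
  moreover have "poly p t = (\<Sum>j\<le>e. c j * t ^ j)" for t
    by (simp add: p_def poly_sum poly_monom)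
  ultimately show ?thesis by simp
qed

text \<open>Induction on the variables: expand \<open>f\<close> in powers of \<open>x i\<close> and
  let \<open>e\<close> be the largest exponent whose coefficient is not identically zero. Each
  nonzero of that coefficient extends to at least \<open>q - e\<close> nonzeros of \<open>f\<close>,
  which supplies the new entry \<open>y i = q - e\<close>. A witness \<open>y\<close>, unlike a
  minimum, can be extended by one entry.\<close>

lemma alon_fueredi:
  fixes f :: "('i \<Rightarrow> 'a::{field,finite}) \<Rightarrow> 'a"
  assumes "finite I" and "polyfun I d f" and "f z \<noteq> 0"
  shows "\<exists>y. (\<forall>i\<in>I. 1 \<le> y i \<and> y i \<le> CARD('a)) \<and>
           int (card I * CARD('a)) \<le> int (sum y I) + d \<and>
           prod y I \<le> card {x \<in> I \<rightarrow>\<^sub>E UNIV. f x \<noteq> 0}"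
  using assms
proof (induction I arbitrary: d f z)
  case empty
  \<comment> \<open>Without variables \<open>f\<close> is a nonzero constant, and the only
    extensional argument is counted, matching the empty product 1.\<close>
  have "d \<ge> 0" using polyfun_neg[OF empty.prems(1), of z] empty.prems(2) by force
  moreover have "f (\<lambda>_. undefined) = f z"
    by (rule polyfun_cong_on[OF empty.prems(1)]) simp
  then have "{x \<in> {} \<rightarrow>\<^sub>E UNIV. f x \<noteq> 0} = {\<lambda>_. undefined}"
    using empty.prems by auto
  ultimately show ?case by simp
next
  case (insert i I)
  let ?q = "CARD('a)"
  obtain c where c: "\<And>j. polyfun I (d - int j) (c j)"
    and f: "\<And>x. f x = (\<Sum>j<?q. c j x * x i ^ j)"
    using polyfun_insert[OF insert.prems(1)] by blast
  define E where "E = {j. j < ?q \<and> (\<exists>x. c j x \<noteq> 0)}"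
  have "finite E" by (simp add: E_def)
  moreover have "E \<noteq> {}"
  proof
    assume "E = {}"
    then have "f z = 0" unfolding f by (intro sum.neutral) (auto simp: E_def)
    with insert.prems show False by simp
  qed
  ultimately have "Max E \<in> E" and max: "\<And>j. j \<in> E \<Longrightarrow> j \<le> Max E"
    by auto
  define e where "e = Max E"
  from \<open>Max E \<in> E\<close> obtain w where e: "e < ?q" and w: "c e w \<noteq> 0"
    by (auto simp: E_def e_def)
  have vanish: "c j x = 0" if "j < ?q" "e < j" for j x
  proof (rule ccontr)
    assume "c j x \<noteq> 0"
    with that have "j \<in> E" by (auto simp: E_def)
    with max that show False by (fastforce simp: e_def)
  qed
  have f_e: "f x = (\<Sum>j\<le>e. c j x * x i ^ j)" for x
    unfolding f by (rule sum.mono_neutral_right) (use e vanish in auto)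
  \<comment> \<open>The degree drop by \<open>e\<close> offsets the new entry \<open>q - e\<close>
    falling short of \<open>q\<close> by \<open>e\<close>.\<close>
  obtain y where y: "\<And>j. j \<in> I \<Longrightarrow> 1 \<le> y j \<and> y j \<le> ?q"
    and y_sum: "int (card I * ?q) \<le> int (sum y I) + (d - int e)"
    and y_prod: "prod y I \<le> card {x \<in> I \<rightarrow>\<^sub>E UNIV. c e x \<noteq> 0}"
    using insert.IH[OF c w] by blast
  \<comment> \<open>Nonzeros of \<open>f\<close> are counted fibrewise: over each \<open>x\<close>
    in \<open>A\<close> lie the values in \<open>B x\<close> of coordinate \<open>i\<close>.\<close>
  define A where "A = {x \<in> I \<rightarrow>\<^sub>E (UNIV::'a set). c e x \<noteq> 0}"
  define B where "B x = {t. (\<Sum>j\<le>e. c j x * t ^ j) \<noteq> 0}" for x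
  define Z where "Z = {x \<in> insert i I \<rightarrow>\<^sub>E UNIV. f x \<noteq> 0}"
  have fin: "finite A" "finite Z"
    using insert.hyps by (simp_all add: A_def Z_def finite_PiE)
  have f_upd: "f (x(i := t)) = (\<Sum>j\<le>e. c j x * t ^ j)" for x t
  proof -
    have "c j (x(i := t)) = c j x" for j
      by (rule polyfun_cong_on[OF c]) (use insert.hyps in auto)
    then show ?thesis by (simp add: f_e)
  qed
  have "(?q - e) * prod y I \<le> (\<Sum>x\<in>A. ?q - e)"
    using y_prod by (simp add: A_def mult.commute)
  also have "\<dots> \<le> (\<Sum>x\<in>A. card (B x))"
    unfolding B_def by (intro sum_mono card_nonroots_ge) (simp add: A_def)
  also have "\<dots> = card (Sigma A B)"
    by (rule card_SigmaI[symmetric]) (use fin in auto)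
  also have "\<dots> \<le> card Z"
  proof (rule card_inj_on_le)
    show "inj_on (\<lambda>(x, t). x(i := t)) (Sigma A B)"
    \<comment> \<open>The inverse reads off coordinate \<open>i\<close> and resets it to
      \<open>undefined\<close>, its value in every extensional function on \<open>I\<close>.\<close>
    proof (rule inj_on_inverseI)
      fix p assume "p \<in> Sigma A B"
      then obtain x t where p: "p = (x, t)" and "x \<in> I \<rightarrow>\<^sub>E (UNIV::'a set)"
        by (auto simp: A_def)
      then have "x i = undefined" using insert.hyps by (auto simp: PiE_def extensional_def)
      then show "(\<lambda>x. (x(i := undefined), x i)) ((\<lambda>(x, t). x(i := t)) p) = p"
        by (auto simp: p)
    qed
    show "(\<lambda>(x, t). x(i := t)) ` Sigma A B \<subseteq> Z"
      by (auto simp: A_def B_def Z_def f_upd PiE_def extensional_def)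
  qed (fact fin)
  finally have "(?q - e) * prod y I \<le> card Z" .
  moreover have "prod (y(i := ?q - e)) I = prod y I" "sum (y(i := ?q - e)) I = sum y I"
    using insert.hyps by (auto intro!: prod.cong sum.cong)
  \<comment> \<open>The new entry is at least 1 because \<open>e < q\<close>.\<close>
  ultimately show ?case
    using insert.hyps y y_sum e
    by (intro exI[of _ "y(i := ?q - e)"]) (auto simp: Z_def of_nat_diff algebra_simps)
qed

section \<open>Tuples of prescribed sum\<close>

text \<open>Lower some entry that is at least 2 by one, as long as the sum exceeds
  \<open>N\<close>.\<close>

lemma ex_le_sum_eq:
  fixes y :: "'i \<Rightarrow> nat"
  assumes "finite I" and "\<And>i. i \<in> I \<Longrightarrow> 1 \<le> y i" and "card I \<le> N" and "N \<le> sum y I"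
  shows "\<exists>y'. (\<forall>i\<in>I. 1 \<le> y' i \<and> y' i \<le> y i) \<and> sum y' I = N"
  using assms(4,2)
proof (induction "sum y I - N" arbitrary: y)
  case 0
  then show ?case by (intro exI[of _ y]) auto
next
  case (Suc m)
  \<comment> \<open>Otherwise all entries are 1 and the sum is \<open>card I\<close>, which does not
    exceed \<open>N\<close>.\<close>
  have "\<exists>i\<in>I. 2 \<le> y i"
  proof (rule ccontr)
    assume "\<not> ?thesis"
    with Suc.prems have "\<forall>i\<in>I. y i = 1" by force
    then have "sum y I = card I" by simp
    with Suc assms(3) show False by simp
  qed
  then obtain i where i: "i \<in> I" "2 \<le> y i" by blast
  define y1 where "y1 = y(i := y i - 1)"
  have "sum y1 I = y1 i + sum y1 (I - {i})" "sum y I = y i + sum y (I - {i})"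
    using i assms(1) by (auto intro: sum.remove)
  moreover have "sum y1 (I - {i}) = sum y (I - {i})"
    by (intro sum.cong) (auto simp: y1_def)
  ultimately have s: "sum y I = Suc (sum y1 I)" using i by (simp add: y1_def)
  obtain y' where y': "\<forall>i\<in>I. 1 \<le> y' i \<and> y' i \<le> y1 i" and "sum y' I = N"
  proof (atomize_elim, rule Suc.hyps(1))
    show "m = sum y1 I - N" "N \<le> sum y1 I" using s Suc.hyps(2) by auto
    show "\<And>j. j \<in> I \<Longrightarrow> 1 \<le> y1 j" using Suc.prems i by (auto simp: y1_def)
  qed
  moreover have "y1 j \<le> y j" for j by (simp add: y1_def)
  then have "\<forall>i\<in>I. 1 \<le> y' i \<and> y' i \<le> y i" using y' by (meson order_trans)
  ultimately show ?case by blast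
qed

text \<open>Lets \<open>Min\<close> in \<open>min_prod\<close> be bounded by any particular
  tuple.\<close>

lemma finite_bounded_tuples: "finite (bounded_tuples as N)"
proof (rule finite_subset)
  show "bounded_tuples as N \<subseteq> {ys. set ys \<subseteq> {..sum_list as} \<and> length ys = length as}"
  proof (clarsimp simp: bounded_tuples_def in_set_conv_nth)
    fix ys i
    assume "\<forall>i<length as. Suc 0 \<le> ys ! i \<and> ys ! i \<le> as ! i" "i < length as"
    then show "ys ! i \<le> sum_list as"
      using elem_le_sum_list[of i as] by (meson order_trans)
  qed
  show "finite {ys. set ys \<subseteq> {..sum_list as} \<and> length ys = length as}"
    by (rule finite_lists_length_eq) simp
qed

text \<open>Passes from sum at least \<open>N\<close>, as \<open>alon_fueredi\<close> delivers it,
  to sum exactly \<open>N\<close>: lowering entries only lowers the product. Below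
  \<open>CARD('i)\<close> the default value 1 is at most any product of positive entries.\<close>

lemma min_prod_replicate_le:
  fixes y :: "'i::finite \<Rightarrow> nat"
  assumes y: "\<And>i. 1 \<le> y i \<and> y i \<le> q" and N: "N \<le> int (sum y UNIV)"
  shows "min_prod (replicate CARD('i) q) N \<le> prod y UNIV"
proof (cases "N < int CARD('i)")
  case True
  have "1 \<le> prod y UNIV" using y by (intro prod_ge_1) auto
  with True show ?thesis by (simp add: min_prod_def)
next
  case False
  then obtain y' where y': "\<And>i. 1 \<le> y' i \<and> y' i \<le> y i" and s: "sum y' UNIV = nat N"
    using ex_le_sum_eq[of UNIV y "nat N"] y N by (auto simp: le_nat_iff nat_le_iff)
  \<comment> \<open>Any enumeration of the indices works, since all entries share the bound
    \<open>q\<close>.\<close>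
  obtain xs :: "'i list" where xs: "distinct xs" "set xs = UNIV"
    using finite_distinct_list[of "UNIV :: 'i set"] by auto
  then have len: "length xs = CARD('i)" by (metis distinct_card)
  have "map y' xs \<in> bounded_tuples (replicate CARD('i) q) N"
    using False s xs len y' y
    by (auto simp: bounded_tuples_def sum_list_distinct_conv_sum_set intro: order_trans)
  then have "min_prod (replicate CARD('i) q) N \<le> prod_list (map y' xs)"
    using False by (auto simp: min_prod_def intro!: Min_le finite_imageI finite_bounded_tuples)
  also have "\<dots> = prod y' UNIV"
    using xs by (simp add: prod.distinct_set_conv_list[symmetric])
  also have "\<dots> \<le> prod y UNIV"
    using y' by (intro prod_mono) auto
  finally show ?thesis .
qed

section \<open>Hyperplanes avoiding a point\<close>

text \<open>The set is a translate of the kernel \<open>W\<close> of the functional given by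
  \<open>a\<close>. A vector \<open>u\<close> with value 1 spans a complement of \<open>W\<close>,
  so \<open>W\<close> has codimension 1.\<close>

lemma affine_hyperplane_dot_eq_1:
  fixes a :: "'a::field ^ 'n"
  assumes "a \<noteq> 0"
  shows "affine_hyperplane {x. (\<Sum>i\<in>UNIV. a $ i * (x $ i - s $ i)) = 1}"
proof -
  define \<phi> where "\<phi> x = (\<Sum>i\<in>UNIV. a $ i * x $ i)" for x :: "'a ^ 'n"
  have add: "\<phi> (x + y) = \<phi> x + \<phi> y" and scale: "\<phi> (r *s x) = r * \<phi> x"
    and diff: "\<phi> (x - y) = \<phi> x - \<phi> y" for x y r
    by (simp_all add: \<phi>_def distrib_left right_diff_distrib sum.distrib sum_subtractf
        sum_distrib_left mult.left_commute)
  obtain i where i: "a $ i \<noteq> 0" using assms by (auto simp: vec_eq_iff)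
  define u where "u = axis i (1 / a $ i)"
  have u: "\<phi> u = 1"
    using i by (simp add: \<phi>_def u_def axis_def if_distrib cong: if_cong)
  define W where "W = {x. \<phi> x = 0}"
  have W: "vec.subspace W"
    unfolding vec.subspace_def W_def by (auto simp: add scale) (simp add: \<phi>_def)
  then have span_W: "vec.span W = W" by (simp add: vec.span_eq_iff)
  \<comment> \<open>Subtracting \<open>\<phi> x\<close> times \<open>u\<close> from \<open>x\<close>
    leaves an element of \<open>W\<close>.\<close>
  have "x \<in> vec.span (insert u W)" for x
    unfolding vec.span_insert span_W
    by (auto simp: W_def diff scale u intro: exI[of _ "\<phi> x"])
  then have "vec.span (insert u W) = UNIV" by auto
  then have "CARD('n) = vec.dim (insert u W)"
    by (metis vec.dim_span vec_dim_card)
  also have "u \<notin> vec.span W"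
    using u by (simp only: span_W) (simp add: W_def)
  then have "vec.dim (insert u W) = vec.dim W + 1"
    by (simp add: vec.dim_insert)
  finally have dim: "vec.dim W = CARD('n) - 1" by simp
  have "{x. \<phi> (x - s) = 1} = (\<lambda>w. (s + u) + w) ` W"
  proof (intro equalityI subsetI)
    fix x assume "x \<in> {x. \<phi> (x - s) = 1}"
    then have "x - (s + u) \<in> W" by (simp add: W_def diff add u algebra_simps)
    then show "x \<in> (\<lambda>w. (s + u) + w) ` W" by (rule rev_image_eqI) simp
  qed (auto simp: W_def diff add u)
  with W dim show ?thesis
    unfolding affine_hyperplane_def \<phi>_def by auto
qed

text \<open>The point \<open>s + axis i r\<close> lies in the set iff \<open>a $ i * r = 1\<close>.
  Hence the axis lines through \<open>s\<close> reveal which coordinates of \<open>a\<close> vanish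
  and the inverses of the others.\<close>

lemma dot_eq_1_inject:
  fixes a b s :: "'a::field ^ 'n"
  assumes "{x. (\<Sum>i\<in>UNIV. a $ i * (x $ i - s $ i)) = 1} =
           {x. (\<Sum>i\<in>UNIV. b $ i * (x $ i - s $ i)) = 1}"
  shows "a = b"
proof -
  have eq: "a $ i * r = 1 \<longleftrightarrow> b $ i * r = 1" for i r
  proof -
    have "(\<Sum>j\<in>UNIV. d $ j * ((s + axis i r) $ j - s $ j)) = d $ i * r" for d :: "'a ^ 'n"
    proof -
      have "d $ j * ((s + axis i r) $ j - s $ j) = (if j = i then d $ i * r else 0)" for j
        by (simp add: axis_def)
      then show ?thesis by simp
    qed
    then show ?thesis using assms unfolding set_eq_iff mem_Collect_eq by metis
  qed
  have "a $ i = b $ i" for i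
    using eq[of i "1 / a $ i"] eq[of i "1 / b $ i"]
    by (cases "a $ i = 0"; cases "b $ i = 0") (auto simp: field_simps)
  then show ?thesis by (simp add: vec_eq_iff)
qed

theorem theorem6p7:
  fixes S :: "('a::{field,finite} ^ 'n) set"
    and q n k :: nat
  assumes "CARD('a) = q"
    and "CARD('n) = n"
    and "card S = k"
    and "k > 0"
  shows "int (card {H :: ('a ^ 'n) set. affine_hyperplane H \<and> H \<inter> S = {}})
           \<ge> int (min_prod (replicate n q) (int n * int q - int k + 1)) - 1"
proof -
  obtain s where s: "s \<in> S" using assms(3,4) by fastforce
  \<comment> \<open>A factor vanishes exactly when \<open>x\<close> lies on \<open>hyp v\<close>.
    The point \<open>s\<close> is on no \<open>hyp v\<close> and needs no factor, which keeps the
    degree at \<open>k - 1\<close>.\<close>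
  define f :: "('n \<Rightarrow> 'a) \<Rightarrow> 'a" where
    "f v = (\<Prod>x\<in>S - {s}. (\<Sum>i\<in>UNIV. v i * (x $ i - s $ i)) + (- 1))" for v
  define Z where "Z = {v. f v \<noteq> 0}"
  define hyp where "hyp v = {x :: 'a ^ 'n. (\<Sum>i\<in>UNIV. v i * (x $ i - s $ i)) = 1}" for v
  define \<H> where "\<H> = {H :: ('a ^ 'n) set. affine_hyperplane H \<and> H \<inter> S = {}}"
  have deg: "polyfun UNIV (int (card (S - {s}))) f"
    unfolding f_def by (rule polyfun_prod_affine) simp
  have f0: "f (\<lambda>_. 0) \<noteq> 0" by (simp add: f_def)
  obtain y :: "'n \<Rightarrow> nat" where y: "\<forall>i. 1 \<le> y i \<and> y i \<le> q"
    and y_sum: "int (n * q) \<le> int (sum y UNIV) + int (card (S - {s}))"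
    and y_prod: "prod y UNIV \<le> card Z"
    using alon_fueredi[OF _ deg f0] unfolding assms(1,2) Z_def by auto
  have "card (S - {s}) = k - 1" using s assms(3) by simp
  then have "int n * int q - int k + 1 \<le> int (sum y UNIV)"
    using y_sum assms(4) by (simp add: of_nat_diff)
  then have "min_prod (replicate n q) (int n * int q - int k + 1) \<le> prod y UNIV"
    unfolding assms(2)[symmetric] using y by (intro min_prod_replicate_le) auto
  also note y_prod
  \<comment> \<open>The zero vector belongs to \<open>Z\<close>, but its \<open>hyp\<close> is
    empty.\<close>
  also have "card Z = Suc (card (Z - {\<lambda>_. 0}))"
    by (rule card.remove) (simp_all add: Z_def f0)
  also have "card (Z - {\<lambda>_. 0}) \<le> card \<H>"
  proof (rule card_inj_on_le)
    show "inj_on hyp (Z - {\<lambda>_. 0})"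
    proof (rule inj_onI)
      fix v w assume "hyp v = hyp w"
      then have "(\<chi> i. v i) = (\<chi> i. w i)"
        by (intro dot_eq_1_inject[where s = s]) (simp add: hyp_def)
      then show "v = w" by (simp add: vec_eq_iff fun_eq_iff)
    qed
    show "hyp ` (Z - {\<lambda>_. 0}) \<subseteq> \<H>"
    proof (rule image_subsetI)
      fix v assume v: "v \<in> Z - {\<lambda>_. 0}"
      have "affine_hyperplane (hyp v)"
        using affine_hyperplane_dot_eq_1[of "\<chi> i. v i" s] v
        by (auto simp: hyp_def vec_eq_iff fun_eq_iff)
      moreover have "x \<notin> hyp v" if "x \<in> S" for x
        using v that by (cases "x = s") (auto simp: hyp_def Z_def f_def)
      ultimately show "hyp v \<in> \<H>" by (auto simp: \<H>_def)
    qed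
  qed simp
  finally show ?thesis by (simp add: \<H>_def)
qed

end
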